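(* Let $\gamma_1>0$, $\gamma_2>0$, $\bm{\Sigma}_0\in\mathbb{S}^p_{++}$, $\bm{\mu}_0,\bar{\bm{\mu}}\in\mathbb{R}^p$, $0<\bar\gamma_1<\bar\gamma_2$, $\theta\ge 0$, $d_0\in\mathbb{R}$, let $X\subseteq\mathbb{R}^n$ be a closed convex set, and let $$h(\bm{x},\bm{\xi})=\max_{k\in\{1,\dots,K\}}\{\bm{a}_k(\bm{x})^T\bm{\xi}+b_k(\bm{x})\},$$ where $\bm{a}_k:\mathbb{R}^n\to\mathbb{R}^p$ and $b_k:\mathbb{R}^n\to\mathbb{R}$ are linear for all $k$. Let $\phi(\bm{\xi},\bm{\xi}')=\theta\|\bm{\xi}-\bm{\xi}'\|_2$, and let $$Y=\{\bm{\xi}\in\mathbb{R}^p : (\bm{\xi}-\bar{\bm{\mu}})^T\bm{\Sigma}_0^{-1}(\bm{\xi}-\bar{\bm{\mu}})\le\bar\gamma_1\},\qquad \Xi=\{\bm{\xi}\in\mathbb{R}^p : (\bm{\xi}-\bar{\bm{\mu}})^T\bm{\Sigma}_0^{-1}(\bm{\xi}-\bar{\bm{\mu}})\le\bar\gamma_2\}.$$ Then the semi-infinite problem $$\begin{aligned} \min_{\bm{x},\bm{\Lambda},\bm{q},t,r}\quad & t+\bm{\Lambda}\cdot(\gamma_2\bm{\Sigma}_0+\bm{\mu}_0\bm{\mu}_0^T)+\sqrt{\gamma_1}\,\|\bm{\Sigma}_0^{1/2}(\bm{q}+2\bm{\Lambda}\bm{\mu}_0)\|_2+\bm{q}^T\bm{\mu}_0+d_0r\\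 \text{s.t.}\quad & h(\bm{x},\bm{\xi})-\bm{\xi}^T\bm{\Lambda}\bm{\xi}-\bm{q}^T\bm{\xi}-t\le r\min_{\bm{\xi}'\in Y}\phi(\bm{\xi},\bm{\xi}')\qquad\forall\,\bm{\xi}\in\Xi,\\ & \bm{\Lambda}\in\mathbb{S}^p_+,\ \bm{q}\in\mathbb{R}^p,\ t\in\mathbb{R},\ r\ge 0,\ \bm{x}\in X \end{aligned}$$ is equivalent to the semidefinite problem $$\begin{aligned} \min_{\bm{x},\bm{\Lambda},\bm{q},t,r,\bm{v}_k,\bm{w}_k,z_{1k},z_{2k}}\quad & t+\bm{\Lambda}\cdot(\gamma_2\bm{\Sigma}_0+\bm{\mu}_0\bm{\mu}_0^T)+\sqrt{\gamma_1}\,\|\bm{\Sigma}_0^{1/2}(\bm{q}+2\bm{\Lambda}\bm{\mu}_0)\|_2+\bm{q}^T\bm{\mu}_0+d_0r\\ \text{s.t.}\quad & \begin{bmatrix}\bm{\Lambda} & \frac12(\bm{v}_k+\bm{w}_k+\bm{q}-\bm{a}_k(\bm{x}))\\ \frac12(\bm{v}_k+\bm{w}_k+\bm{q}-\bm{a}_k(\bm{x}))^T & t-b_k(\bm{x})-\bar{\bm{\mu}}^T(\bm{v}_k+\bm{w}_k)-z_{1k}-z_{2k}\end{bmatrix}\in\mathbb{S}^{p+1}_+,\\ & \sqrt{\bar\gamma_1}\,\|\bm{\Sigma}_0^{1/2}\bm{v}_k\|_2\le z_{1k},\qquad \sqrt{\bar\gamma_2}\,\|\bm{\Sigma}_0^{1/2}\bm{w}_k\|_2\le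 z_{2k},\qquad \|\bm{v}_k\|_2\le r\theta,\\ & \bm{v}_k,\bm{w}_k\in\mathbb{R}^p,\ z_{1k},z_{2k}\in\mathbb{R},\quad 1\le k\le K,\\ & \bm{\Lambda}\in\mathbb{S}^p_+,\ \bm{q}\in\mathbb{R}^p,\ t\in\mathbb{R},\ r\ge 0,\ \bm{x}\in X, \end{aligned}$$ in the sense that $(\bm{x},\bm{\Lambda},\bm{q},t,r)$ is feasible for the first problem if and only if there exist $\bm{v}_k,\bm{w}_k,z_{1k},z_{2k}$ ($1\le k\le K$) such that $(\bm{x},\bm{\Lambda},\bm{q},t,r,(\bm{v}_k,\bm{w}_k,z_{1k},z_{2k})_{k=1}^K)$ is feasible for the second; the objective functions coincide, so the two problems have the same optimal value and the same optimal $(\bm{x},\bm{\Lambda},\bm{q},t,r)$.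
   Context: $\mathbb{S}^p$ is the set of real symmetric $p\times p$ matrices; $\mathbb{S}^p_+$ and $\mathbb{S}^p_{++}$ are its subsets of positive semidefinite and positive definite matrices. $\bm{A}\cdot\bm{B}=\mathrm{tr}(\bm{A}^T\bm{B})$ is the trace inner product. $\bm{\Sigma}_0^{1/2}$ is a fixed $p\times p$ matrix with $\bm{\Sigma}_0=(\bm{\Sigma}_0^{1/2})^T\bm{\Sigma}_0^{1/2}$. $n,p,K$ are positive integers. *)

theory Defs
  imports "HOL-Analysis.Analysis"
begin


definition psd :: "real^'m^'m \<Rightarrow> bool" where
  "psd A \<longleftrightarrow> transpose A = A \<and> (\<forall>x. 0 \<le> x \<bullet> (A *v x))"

definition pd :: "real^'m^'m \<Rightarrow> bool" where
  "pd A \<longleftrightarrow> transpose A = A \<and> (\<forall>x. x \<noteq> 0 \<longrightarrow> 0 < x \<bullet> (A *v x))"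

definition trace_inner :: "real^'m^'m \<Rightarrow> real^'m^'m \<Rightarrow> real" where
  "trace_inner A B = trace (transpose A ** B)"

definition outer_prod :: "real^'m \<Rightarrow> real^'m \<Rightarrow> real^'m^'m" where
  "outer_prod u w = (\<chi> i j. u $ i * w $ j)"

text \<open>
  The symmetric block matrix with blocks \<open>A\<close>, \<open>u\<close>, \<open>u\<^sup>T\<close>, \<open>c\<close>; the index type
  \<open>'m + unit\<close> has one element more than \<open>'m\<close>.
\<close>
definition bordered :: "real^'m^'m \<Rightarrow> real^'m \<Rightarrow> real \<Rightarrow> real^('m + unit)^('m + unit)" where
  "bordered A u c = (\<chi> i j. case i of
       Inl i' \<Rightarrow> (case j of Inl j' \<Rightarrow> A $ i' $ j' | Inr _ \<Rightarrow> u $ i')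
     | Inr _ \<Rightarrow> (case j of Inl j' \<Rightarrow> u $ j' | Inr _ \<Rightarrow> c))"


text \<open>
  The dimensions \<open>n\<close>, \<open>p\<close> and the number \<open>K\<close> of pieces are the cardinalities of the finite
  (hence nonempty) index types \<open>'n\<close>, \<open>'p\<close>, \<open>'k\<close>.
\<close>
definition max_affine ::
  "('k::finite \<Rightarrow> real^'n \<Rightarrow> real^'p) \<Rightarrow> ('k \<Rightarrow> real^'n \<Rightarrow> real) \<Rightarrow> real^'n \<Rightarrow> real^'p \<Rightarrow> real" where
  "max_affine a b x \<xi> = Max (range (\<lambda>k. a k x \<bullet> \<xi> + b k x))"

definition transport_cost :: "real \<Rightarrow> real^'p \<Rightarrow> real^'p \<Rightarrow> real" where
  "transport_cost \<theta> \<xi> \<xi>' = \<theta> * norm (\<xi> - \<xi>')"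

definition ellipsoid :: "real^'p^'p \<Rightarrow> real^'p \<Rightarrow> real \<Rightarrow> (real^'p) set" where
  "ellipsoid \<Sigma> \<mu> \<rho> = {\<xi>. (\<xi> - \<mu>) \<bullet> (matrix_inv \<Sigma> *v (\<xi> - \<mu>)) \<le> \<rho>}"

text \<open>
  The infimum of the transport cost over an ellipsoid is a minimum, so writing
  the minimum over \<open>Y\<close> as \<open>INF\<close> below loses nothing.
\<close>
lemma transport_cost_attains_INF:
  assumes "0 \<le> \<theta>" "0 < \<rho>"
  shows "\<exists>\<xi>'\<in>ellipsoid \<Sigma> \<mu> \<rho>.
           transport_cost \<theta> \<xi> \<xi>' = (INF \<eta>\<in>ellipsoid \<Sigma> \<mu> \<rho>. transport_cost \<theta> \<xi> \<eta>)"
proof -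
  have ne: "ellipsoid \<Sigma> \<mu> \<rho> \<noteq> {}"
  proof -
    have "\<mu> \<in> ellipsoid \<Sigma> \<mu> \<rho>"
      using assms by (simp add: ellipsoid_def)
    then show ?thesis by blast
  qed
  have "closed (ellipsoid \<Sigma> \<mu> \<rho>)"
    unfolding ellipsoid_def
    by (intro closed_Collect_le continuous_intros
        bounded_linear.continuous_on[OF matrix_vector_mul_bounded_linear])
  then obtain \<xi>' where \<xi>': "\<xi>' \<in> ellipsoid \<Sigma> \<mu> \<rho>"
    and le: "\<And>\<eta>. \<eta> \<in> ellipsoid \<Sigma> \<mu> \<rho> \<Longrightarrow> dist \<xi> \<xi>' \<le> dist \<xi> \<eta>"
    using distance_attains_inf[OF _ ne] by metis
  have "(INF \<eta>\<in>ellipsoid \<Sigma> \<mu> \<rho>. transport_cost \<theta> \<xi> \<eta>) = transport_cost \<theta> \<xi> \<xi>'"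
    using \<xi>' le assms
    by (intro cInf_eq_minimum) (auto simp: transport_cost_def dist_norm intro: mult_left_mono)
  then show ?thesis using \<xi>' by auto
qed


text \<open>Decision variables of the semi-infinite problem: \<open>(x, \<Lambda>, q, t, r)\<close>.\<close>
type_synonym ('n, 'p) sip_vars = "(real^'n) \<times> (real^'p^'p) \<times> (real^'p) \<times> real \<times> real"

text \<open>
  Decision variables of the semidefinite problem: those of the semi-infinite problem, paired with
  the families \<open>(v, w, z\<^sub>1, z\<^sub>2)\<close>.
\<close>
type_synonym ('n, 'p, 'k) sdp_vars =
  "('n, 'p) sip_vars \<times> ('k \<Rightarrow> real^'p) \<times> ('k \<Rightarrow> real^'p) \<times> ('k \<Rightarrow> real) \<times> ('k \<Rightarrow> real)"

text \<open>In the objectives, \<open>S\<close> stands for \<open>\<Sigma>\<^sub>0\<^sup>1\<^sup>/\<^sup>2\<close>.\<close>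
fun sip_objective ::
  "real \<Rightarrow> real \<Rightarrow> real^'p^'p \<Rightarrow> real^'p^'p \<Rightarrow> real^'p \<Rightarrow> real \<Rightarrow> ('n, 'p) sip_vars \<Rightarrow> real" where
  "sip_objective \<gamma>1 \<gamma>2 \<Sigma>0 S \<mu>0 d0 (x, \<Lambda>, q, t, r) =
     t + trace_inner \<Lambda> (\<gamma>2 *\<^sub>R \<Sigma>0 + outer_prod \<mu>0 \<mu>0)
       + sqrt \<gamma>1 * norm (S *v (q + 2 *\<^sub>R (\<Lambda> *v \<mu>0))) + q \<bullet> \<mu>0 + d0 * r"

fun sdp_objective ::
  "real \<Rightarrow> real \<Rightarrow> real^'p^'p \<Rightarrow> real^'p^'p \<Rightarrow> real^'p \<Rightarrow> real \<Rightarrow> ('n, 'p, 'k) sdp_vars \<Rightarrow> real" where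
  "sdp_objective \<gamma>1 \<gamma>2 \<Sigma>0 S \<mu>0 d0 ((x, \<Lambda>, q, t, r), v, w, z1, z2) =
     t + trace_inner \<Lambda> (\<gamma>2 *\<^sub>R \<Sigma>0 + outer_prod \<mu>0 \<mu>0)
       + sqrt \<gamma>1 * norm (S *v (q + 2 *\<^sub>R (\<Lambda> *v \<mu>0))) + q \<bullet> \<mu>0 + d0 * r"

definition sip_feasible ::
  "(real^'n) set \<Rightarrow> (real^'n \<Rightarrow> real^'p \<Rightarrow> real) \<Rightarrow> (real^'p \<Rightarrow> real^'p \<Rightarrow> real)
     \<Rightarrow> (real^'p) set \<Rightarrow> (real^'p) set \<Rightarrow> ('n, 'p) sip_vars set" where
  "sip_feasible X h \<phi> Y \<Xi> = {(x, \<Lambda>, q, t, r).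
     (\<forall>\<xi>\<in>\<Xi>. h x \<xi> - \<xi> \<bullet> (\<Lambda> *v \<xi>) - q \<bullet> \<xi> - t \<le> r * (INF \<xi>'\<in>Y. \<phi> \<xi> \<xi>'))
     \<and> psd \<Lambda> \<and> 0 \<le> r \<and> x \<in> X}"

definition sdp_feasible ::
  "(real^'n) set \<Rightarrow> ('k \<Rightarrow> real^'n \<Rightarrow> real^'p) \<Rightarrow> ('k \<Rightarrow> real^'n \<Rightarrow> real)
     \<Rightarrow> real^'p^'p \<Rightarrow> real^'p \<Rightarrow> real \<Rightarrow> real \<Rightarrow> real \<Rightarrow> ('n, 'p, 'k) sdp_vars set" where
  "sdp_feasible X a b S \<mu> \<rho>1 \<rho>2 \<theta> = {((x, \<Lambda>, q, t, r), v, w, z1, z2).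
     (\<forall>k. psd (bordered \<Lambda> ((1/2) *\<^sub>R (v k + w k + q - a k x))
                 (t - b k x - \<mu> \<bullet> (v k + w k) - z1 k - z2 k))
        \<and> sqrt \<rho>1 * norm (S *v v k) \<le> z1 k
        \<and> sqrt \<rho>2 * norm (S *v w k) \<le> z2 k
        \<and> norm (v k) \<le> r * \<theta>)
     \<and> psd \<Lambda> \<and> 0 \<le> r \<and> x \<in> X}"

text \<open>Extended-real valued: \<open>\<infinity>\<close> if infeasible, \<open>-\<infinity>\<close> if unbounded below.\<close>
definition optimal_value :: "('z \<Rightarrow> real) \<Rightarrow> 'z set \<Rightarrow> ereal" where
  "optimal_value f F = (INF z\<in>F. ereal (f z))"

definition optimal_solutions :: "('z \<Rightarrow> real) \<Rightarrow> 'z set \<Rightarrow> 'z set" where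
  "optimal_solutions f F = {z. is_arg_min f (\<lambda>y. y \<in> F) z}"

end

theory Submission
  imports Defs
begin

text \<open>
  For each piece \<open>k\<close> the semi-infinite constraint says that a concave quadratic \<open>f\<close> satisfies
  \<open>f \<xi> \<le> c * infdist \<xi> Y\<close> for \<open>\<xi> \<in> \<Xi>\<close>, where \<open>c = r * \<theta>\<close>. Two applications of the sandwich theorem (an affine function
  fits between a concave function and a convex function above it) produce the multipliers: first
  \<open>w\<close>, between \<open>f \<xi> - c * infdist \<xi> Y\<close> and the zero function on \<open>\<Xi>\<close>; then \<open>v\<close>, between
  \<open>f\<close> minus the first affine function and \<open>c * infdist \<xi> Y\<close>. The norm constraints are the support
  functions of the two ellipsoids, and the bordered matrix is positive semidefinite exactly when the
  resulting quadratic inequality holds on the whole space.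
\<close>

section \<open>Separation of a concave function from a convex function above it\<close>

lemma convex_hypograph:
  assumes "concave_on S f"
  shows "convex {(x, s). x \<in> S \<and> s \<le> f x}"
proof (rule convexI, clarsimp)
  fix x y s t and u v :: real
  assume *: "x \<in> S" "y \<in> S" "s \<le> f x" "t \<le> f y" "0 \<le> u" "0 \<le> v" "u + v = 1"
  then have "u * s + v * t \<le> u * f x + v * f y"
    by (intro add_mono mult_left_mono)
  also have "\<dots> \<le> f (u *\<^sub>R x + v *\<^sub>R y)"
    using assms * by (simp add: concave_on_iff)
  finally show "u *\<^sub>R x + v *\<^sub>R y \<in> S \<and> u * s + v * t \<le> f (u *\<^sub>R x + v *\<^sub>R y)"
    using assms * by (auto dest!: concave_on_imp_convex simp: convex_def)
qed

lemma convex_strict_epigraph: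
  assumes "convex_on S f"
  shows "convex {(x, s). x \<in> S \<and> f x < s}"
proof (rule convexI, clarsimp)
  fix x y s t and u v :: real
  assume *: "x \<in> S" "y \<in> S" "f x < s" "f y < t" "0 \<le> u" "0 \<le> v" "u + v = 1"
  have "f (u *\<^sub>R x + v *\<^sub>R y) \<le> u * f x + v * f y"
    using assms * by (simp add: convex_on_def)
  also have "\<dots> < u * s + v * t"
  proof (cases "u = 0")
    case False
    with * show ?thesis by (intro add_less_le_mono mult_strict_left_mono mult_left_mono) auto
  qed (use * in auto)
  finally show "u *\<^sub>R x + v *\<^sub>R y \<in> S \<and> f (u *\<^sub>R x + v *\<^sub>R y) < u * s + v * t"
    using assms * by (auto dest!: convex_on_imp_convex simp: convex_def)
qed

text \<open>A hyperplane separates the hypograph of \<open>f\<close> from the strict epigraph of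
  \<open>g\<close> over \<open>D\<close>. It is the graph of an affine function because it cannot be
  vertical: \<open>f\<close> is finite on the whole space, so its hypograph lies over every
  point.\<close>

lemma affine_sandwich:
  fixes f g :: "'a::euclidean_space \<Rightarrow> real"
  assumes f: "concave_on UNIV f" and g: "convex_on D g" and "D \<noteq> {}"
    and le: "\<And>x. x \<in> D \<Longrightarrow> f x \<le> g x"
  obtains v c where "\<And>x. f x \<le> v \<bullet> x + c" and "\<And>x. x \<in> D \<Longrightarrow> v \<bullet> x + c \<le> g x"
proof -
  let ?L = "{(x, s). x \<in> UNIV \<and> s \<le> f x}" and ?U = "{(x, s). x \<in> D \<and> g x < s}"
  obtain d where d: "d \<in> D" using \<open>D \<noteq> {}\<close> by blast
  have "(undefined, f undefined) \<in> ?L" "(d, g d + 1) \<in> ?U"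
    using d by auto
  then have "?L \<noteq> {}" "?U \<noteq> {}" by blast+
  \<comment> \<open>Strictness in the epigraph gives disjointness even where \<open>f\<close> and
    \<open>g\<close> touch.\<close>
  moreover have "?L \<inter> ?U = {}" using le by fastforce
  ultimately obtain z b where z: "z \<noteq> 0" "\<forall>y\<in>?L. z \<bullet> y \<le> b" "\<forall>y\<in>?U. z \<bullet> y \<ge> b"
    using separating_hyperplane_sets[OF convex_hypograph[OF f] convex_strict_epigraph[OF g]]
    by meson
  obtain u l where ul: "z = (u, l)" by (cases z)
  have lower: "u \<bullet> x + l * s \<le> b" if "s \<le> f x" for x s
    using z(2) that by (auto simp: ul)
  have upper: "b \<le> u \<bullet> x + l * s" if "x \<in> D" "g x < s" for x s
    using z(3) that by (auto simp: ul)
  \<comment> \<open>For a vertical hyperplane the linear form of \<open>u\<close> would be bounded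
    above by \<open>b\<close> on the whole space. This forces \<open>u = 0\<close>, against
    \<open>z \<noteq> 0\<close>.\<close>
  have "l \<noteq> 0"
  proof
    assume "l = 0"
    then have bd: "u \<bullet> x \<le> b" for x using lower[of "f x" x] by simp
    have "u = 0"
    proof (rule ccontr)
      assume "u \<noteq> 0"
      then have "u \<bullet> (((b + 1) / (u \<bullet> u)) *\<^sub>R u) = b + 1" by simp
      with bd[of "((b + 1) / (u \<bullet> u)) *\<^sub>R u"] show False by linarith
    qed
    with \<open>l = 0\<close> z(1) ul show False by (simp add: zero_prod_def)
  qed
  moreover have "\<not> l < 0"
  proof
    assume l: "l < 0"
    \<comment> \<open>The hypograph extends downwards without bound: \<open>s\<close> is at most
      \<open>f d\<close> and so low that, with \<open>l\<close> negative, the separating functional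
      reaches \<open>b + 1\<close> at \<open>(d, s)\<close>.\<close>
    define s where "s = min (f d) ((b + 1 - u \<bullet> d) / l)"
    have "s \<le> (b + 1 - u \<bullet> d) / l" by (simp add: s_def)
    then have "b + 1 - u \<bullet> d \<le> l * s" using l by (simp add: field_simps)
    moreover have "u \<bullet> d + l * s \<le> b" by (rule lower) (simp add: s_def)
    ultimately show False by linarith
  qed
  ultimately have l: "0 < l" by linarith
  show ?thesis
  \<comment> \<open>The equation \<open>u \<bullet> x + l * s = b\<close> of the hyperplane, solved
    for \<open>s\<close>.\<close>
  proof (rule that[of "(- 1 / l) *\<^sub>R u" "b / l"])
    fix x
    have "l * f x \<le> b - u \<bullet> x" using lower[of "f x" x] by simp
    then show "f x \<le> ((- 1 / l) *\<^sub>R u) \<bullet> x + b / l"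
      using l by (simp add: field_simps)
  next
    fix x assume x: "x \<in> D"
    have "(b - u \<bullet> x) / l \<le> g x"
    \<comment> \<open>Separation speaks only of heights strictly above \<open>g x\<close>; density
      of the reals carries the bound down to \<open>g x\<close> itself.\<close>
    proof (rule dense_ge)
      fix s assume "g x < s"
      from upper[OF x this] show "(b - u \<bullet> x) / l \<le> s"
        using l by (simp add: field_simps)
    qed
    then show "((- 1 / l) *\<^sub>R u) \<bullet> x + b / l \<le> g x"
      by (simp add: diff_divide_distrib)
  qed
qed

section \<open>Convexity of the distance to a convex set and of a semidefinite form\<close>

lemma convex_on_infdist:
  fixes A :: "'a::euclidean_space set"
  assumes "convex A" "closed A" "A \<noteq> {}"
  shows "convex_on UNIV (\<lambda>x. infdist x A)"
  unfolding convex_on_def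
proof (intro conjI ballI allI impI)
  fix x y :: 'a and u v :: real
  assume uv: "0 \<le> u" "0 \<le> v" "u + v = 1"
  obtain x' y' where x': "x' \<in> A" "infdist x A = dist x x'" and y': "y' \<in> A" "infdist y A = dist y y'"
    using infdist_attains_inf[OF assms(2,3)] by metis
  \<comment> \<open>The convex combination of the two nearest points is a competitor for the
    distance of the combined point.\<close>
  have "u *\<^sub>R x' + v *\<^sub>R y' \<in> A"
    using assms(1) x' y' uv by (simp add: convex_def)
  then have "infdist (u *\<^sub>R x + v *\<^sub>R y) A \<le> dist (u *\<^sub>R x + v *\<^sub>R y) (u *\<^sub>R x' + v *\<^sub>R y')"
    by (rule infdist_le)
  also have "\<dots> = norm (u *\<^sub>R (x - x') + v *\<^sub>R (y - y'))"
    by (simp add: dist_norm algebra_simps)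
  also have "\<dots> \<le> u * dist x x' + v * dist y y'"
    using norm_triangle_ineq[of "u *\<^sub>R (x - x')" "v *\<^sub>R (y - y')"] uv by (simp add: dist_norm)
  finally show "infdist (u *\<^sub>R x + v *\<^sub>R y) A \<le> u * infdist x A + v * infdist y A"
    by (simp add: x' y')
qed simp

text \<open>The gap in the convexity inequality is exactly \<open>u * v\<close> times the form
  evaluated at \<open>x - y\<close>.\<close>

lemma convex_on_psd:
  assumes "psd \<Lambda>"
  shows "convex_on UNIV (\<lambda>x. x \<bullet> (\<Lambda> *v x))"
  unfolding convex_on_def
proof (intro conjI ballI allI impI)
  fix x y and u v :: real
  assume uv: "0 \<le> u" "0 \<le> v" "u + v = 1"
  let ?q = "\<lambda>x y. x \<bullet> (\<Lambda> *v y)"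
  have "v = 1 - u" using uv by simp
  have "u * ?q x x + v * ?q y y - ?q (u *\<^sub>R x + v *\<^sub>R y) (u *\<^sub>R x + v *\<^sub>R y)
      = u * v * ?q (x - y) (x - y)"
    unfolding \<open>v = 1 - u\<close>
    by (simp add: matrix_vector_right_distrib matrix_vector_mult_diff_distrib
        matrix_vector_mult_scaleR inner_add_left inner_add_right inner_diff_left inner_diff_right
        algebra_simps)
  moreover have "0 \<le> u * v * ?q (x - y) (x - y)"
    using assms uv by (simp add: psd_def)
  ultimately show "?q (u *\<^sub>R x + v *\<^sub>R y) (u *\<^sub>R x + v *\<^sub>R y) \<le> u * ?q x x + v * ?q y y"
    by linarith
qed simp

section \<open>Ellipsoids as affine images of balls, and their support functions\<close>

lemma invertible_factor:
  fixes S :: "real^'p^'p"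
  assumes "pd \<Sigma>" and "\<Sigma> = transpose S ** S"
  shows "invertible S"
proof -
  have "x = 0" if "S *v x = 0" for x
  proof (rule ccontr)
    assume "x \<noteq> 0"
    then have "0 < x \<bullet> (\<Sigma> *v x)" using assms(1) by (simp add: pd_def)
    also have "\<Sigma> *v x = 0"
      using that by (simp add: assms(2) flip: matrix_vector_mul_assoc)
    finally show False by simp
  qed
  then show ?thesis
    by (simp add: invertible_left_inverse matrix_left_invertible_ker)
qed

lemma invertible_transpose:
  fixes S :: "real^'p^'p"
  assumes "invertible S"
  shows "invertible (transpose S)"
proof -
  obtain B where "S ** B = mat 1" "B ** S = mat 1"
    using assms by (auto simp: invertible_def)
  then have "transpose B ** transpose S = mat 1" "transpose S ** transpose B = mat 1"
    by (simp_all flip: matrix_transpose_mul)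
  then show ?thesis by (auto simp: invertible_def)
qed

lemma matrix_inv_mult_left:
  assumes "invertible A"
  shows "matrix_inv A ** A = mat 1"
  using someI_ex[OF assms[unfolded invertible_def]] unfolding matrix_inv_def by blast

text \<open>Under the substitution \<open>\<xi> - \<mu> = transpose S *v u\<close> the form of the
  inverse of \<open>\<Sigma>\<close> becomes the squared norm of \<open>u\<close>, since that
  inverse times \<open>transpose S\<close> is the inverse of \<open>S\<close>.\<close>

lemma ellipsoid_eq_image_cball:
  fixes S :: "real^'p^'p"
  assumes "invertible S" and "\<Sigma> = transpose S ** S" and "0 \<le> \<rho>"
  shows "ellipsoid \<Sigma> \<mu> \<rho> = (\<lambda>u. \<mu> + transpose S *v u) ` cball 0 (sqrt \<rho>)"
proof -
  have quad: "(transpose S *v u) \<bullet> (matrix_inv \<Sigma> *v (transpose S *v u)) = (norm u)\<^sup>2" for u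
  proof -
    have inv\<Sigma>: "invertible \<Sigma>"
      unfolding assms(2) by (intro invertible_mult invertible_transpose assms(1))
    obtain y where y: "S *v y = u"
      using assms(1) by (metis invertible_def matrix_vector_mul_assoc matrix_vector_mul_lid)
    have "transpose S *v u = \<Sigma> *v y"
      using y by (simp add: assms(2) flip: matrix_vector_mul_assoc)
    moreover have "matrix_inv \<Sigma> *v (\<Sigma> *v y) = y"
      using matrix_inv_mult_left[OF inv\<Sigma>] by (simp add: matrix_vector_mul_assoc)
    ultimately have "(transpose S *v u) \<bullet> (matrix_inv \<Sigma> *v (transpose S *v u))
        = (transpose S *v u) \<bullet> y" by simp
    also have "\<dots> = u \<bullet> (S *v y)" by (simp add: dot_lmul_matrix)
    finally show ?thesis by (simp add: y power2_norm_eq_inner)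
  qed
  have mem: "\<mu> + transpose S *v u \<in> ellipsoid \<Sigma> \<mu> \<rho> \<longleftrightarrow> u \<in> cball 0 (sqrt \<rho>)" for u
    using quad[of u] real_le_rsqrt real_sqrt_le_iff[of "(norm u)\<^sup>2" \<rho>]
    by (simp add: ellipsoid_def)
  show ?thesis
  proof (intro set_eqI iffI)
    fix \<xi> assume \<xi>: "\<xi> \<in> ellipsoid \<Sigma> \<mu> \<rho>"
    obtain u where "transpose S *v u = \<xi> - \<mu>"
      using invertible_transpose[OF assms(1)]
      by (metis invertible_def matrix_vector_mul_assoc matrix_vector_mul_lid)
    then have u: "\<xi> = \<mu> + transpose S *v u" by (simp only: add_diff_cancel_left' add_diff_eq)
    show "\<xi> \<in> (\<lambda>u. \<mu> + transpose S *v u) ` cball 0 (sqrt \<rho>)"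
      using \<xi> mem unfolding u by (intro imageI) blast
  next
    fix \<xi> assume "\<xi> \<in> (\<lambda>u. \<mu> + transpose S *v u) ` cball 0 (sqrt \<rho>)"
    then obtain u where "u \<in> cball 0 (sqrt \<rho>)" "\<xi> = \<mu> + transpose S *v u" by (rule imageE)
    then show "\<xi> \<in> ellipsoid \<Sigma> \<mu> \<rho>" using mem by blast
  qed
qed

text \<open>Convexity and closedness pass from the ball through the affine map. For the support
  function, moving \<open>transpose S\<close> across the inner product leaves the maximum of a
  linear form with coefficient \<open>S *v v\<close> over a ball of radius
  \<open>sqrt \<rho>\<close>.\<close>

lemma
  fixes S :: "real^'p^'p"
  assumes "invertible S" and "\<Sigma> = transpose S ** S" and "0 \<le> \<rho>"
  shows convex_ellipsoid: "convex (ellipsoid \<Sigma> \<mu> \<rho>)"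
    and closed_ellipsoid: "closed (ellipsoid \<Sigma> \<mu> \<rho>)"
    and center_in_ellipsoid: "\<mu> \<in> ellipsoid \<Sigma> \<mu> \<rho>"
    and ellipsoid_support_le_iff:
      "(\<forall>\<xi>\<in>ellipsoid \<Sigma> \<mu> \<rho>. v \<bullet> (\<xi> - \<mu>) \<le> z) \<longleftrightarrow> sqrt \<rho> * norm (S *v v) \<le> z"
proof -
  note eq = ellipsoid_eq_image_cball[OF assms]
  have img: "ellipsoid \<Sigma> \<mu> \<rho> = (+) \<mu> ` (*v) (transpose S) ` cball 0 (sqrt \<rho>)"
    unfolding eq image_image ..
  show "convex (ellipsoid \<Sigma> \<mu> \<rho>)"
    unfolding img
    by (intro convex_translation convex_linear_image matrix_vector_mul_linear convex_cball)
  show "closed (ellipsoid \<Sigma> \<mu> \<rho>)"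
    unfolding img
    by (intro compact_imp_closed compact_translation compact_continuous_image
        linear_continuous_on matrix_vector_mul_bounded_linear compact_cball)
  show "\<mu> \<in> ellipsoid \<Sigma> \<mu> \<rho>"
    using assms(3) by (simp add: ellipsoid_def)
  have pair: "v \<bullet> (transpose S *v u) = (S *v v) \<bullet> u" for u
    using dot_lmul_matrix[of u S v] by (simp add: inner_commute)
  show "(\<forall>\<xi>\<in>ellipsoid \<Sigma> \<mu> \<rho>. v \<bullet> (\<xi> - \<mu>) \<le> z) \<longleftrightarrow> sqrt \<rho> * norm (S *v v) \<le> z"
    unfolding eq ball_simps add_diff_cancel_left' pair
  proof
    assume bd: "\<forall>u\<in>cball 0 (sqrt \<rho>). (S *v v) \<bullet> u \<le> z"
    \<comment> \<open>The maximiser on the ball; since \<open>sgn 0 = 0\<close>, it lies in the ball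
      also when \<open>S *v v = 0\<close>.\<close>
    let ?u = "sqrt \<rho> *\<^sub>R sgn (S *v v)"
    have "?u \<in> cball 0 (sqrt \<rho>)" using assms(3) by (simp add: norm_sgn)
    with bd have "(S *v v) \<bullet> ?u \<le> z" by blast
    also have "(S *v v) \<bullet> ?u = sqrt \<rho> * norm (S *v v)"
      by (cases "S *v v = 0")
        (simp_all add: sgn_div_norm power2_norm_eq_inner[symmetric] power2_eq_square)
    finally show "sqrt \<rho> * norm (S *v v) \<le> z" .
  next
    assume z: "sqrt \<rho> * norm (S *v v) \<le> z"
    show "\<forall>u\<in>cball 0 (sqrt \<rho>). (S *v v) \<bullet> u \<le> z"
    proof
      fix u :: "real^'p" assume "u \<in> cball 0 (sqrt \<rho>)"
      then have "norm (S *v v) * norm u \<le> norm (S *v v) * sqrt \<rho>"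
        by (intro mult_left_mono) auto
      with norm_cauchy_schwarz[of "S *v v" u] z show "(S *v v) \<bullet> u \<le> z"
        by (simp add: mult.commute)
    qed
  qed
qed

section \<open>Multipliers for a single affine piece\<close>

lemma INF_transport_cost:
  assumes "closed Y" "Y \<noteq> {}" "0 \<le> \<theta>"
  shows "(INF \<eta>\<in>Y. transport_cost \<theta> \<xi> \<eta>) = \<theta> * infdist \<xi> Y"
proof -
  obtain \<eta> where \<eta>: "\<eta> \<in> Y" "infdist \<xi> Y = dist \<xi> \<eta>"
    using infdist_attains_inf[OF assms(1,2)] by metis
  have "\<theta> * dist \<xi> \<eta> \<le> \<theta> * dist \<xi> \<eta>'" if "\<eta>' \<in> Y" for \<eta>'
    using infdist_le[OF that, of \<xi>] \<eta> assms(3) by (intro mult_left_mono) simp_all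
  then show ?thesis
    unfolding \<eta>(2) using \<eta>(1)
    by (intro cInf_eq_minimum) (auto simp: transport_cost_def dist_norm)
qed

text \<open>Lagrangian duality for one piece: \<open>w\<close> prices membership of
  \<open>\<xi>\<close> in the large ellipsoid, \<open>v\<close> is dual to the distance from the
  small one, and \<open>z1\<close>, \<open>z2\<close> bound the two support functions.\<close>

lemma semi_infinite_iff_multipliers:
  fixes S \<Lambda> :: "real^'p^'p"
  assumes "invertible S" and "\<Sigma> = transpose S ** S" and "0 \<le> \<rho>1" "0 \<le> \<rho>2"
    and "psd \<Lambda>" and "0 \<le> c"
  shows "(\<forall>\<xi>\<in>ellipsoid \<Sigma> \<mu> \<rho>2.
            \<alpha> \<bullet> \<xi> + \<beta> - \<xi> \<bullet> (\<Lambda> *v \<xi>) \<le> c * infdist \<xi> (ellipsoid \<Sigma> \<mu> \<rho>1)) \<longleftrightarrow>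
    (\<exists>v w z1 z2. (\<forall>\<xi>. \<alpha> \<bullet> \<xi> + \<beta> - \<xi> \<bullet> (\<Lambda> *v \<xi>) \<le> (v + w) \<bullet> (\<xi> - \<mu>) - z1 - z2)
        \<and> sqrt \<rho>1 * norm (S *v v) \<le> z1 \<and> sqrt \<rho>2 * norm (S *v w) \<le> z2 \<and> norm v \<le> c)"
    (is "?lhs \<longleftrightarrow> ?rhs")
proof -
  let ?Y = "ellipsoid \<Sigma> \<mu> \<rho>1" and ?\<Xi> = "ellipsoid \<Sigma> \<mu> \<rho>2"
  define f where "f \<xi> = \<alpha> \<bullet> \<xi> + \<beta> - \<xi> \<bullet> (\<Lambda> *v \<xi>)" for \<xi>
  note Y = convex_ellipsoid[OF assms(1-3), of \<mu>] closed_ellipsoid[OF assms(1-3), of \<mu>]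
    center_in_ellipsoid[OF assms(1-3), of \<mu>]
  note \<Xi> = convex_ellipsoid[OF assms(1,2,4), of \<mu>] center_in_ellipsoid[OF assms(1,2,4), of \<mu>]
  note supportY = ellipsoid_support_le_iff[OF assms(1-3), of \<mu>, symmetric]
  note support\<Xi> = ellipsoid_support_le_iff[OF assms(1,2,4), of \<mu>, symmetric]
  have neY: "?Y \<noteq> {}" using Y by blast
  show ?thesis
  proof
    assume ?rhs
    then obtain v w z1 z2 where f: "\<And>\<xi>. f \<xi> \<le> (v + w) \<bullet> (\<xi> - \<mu>) - z1 - z2"
      and z1: "\<forall>\<xi>\<in>?Y. v \<bullet> (\<xi> - \<mu>) \<le> z1" and z2: "\<forall>\<xi>\<in>?\<Xi>. w \<bullet> (\<xi> - \<mu>) \<le> z2"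
      and v: "norm v \<le> c"
      unfolding supportY support\<Xi> f_def by blast
    show ?lhs
      unfolding f_def[symmetric]
    proof
      fix \<xi> assume "\<xi> \<in> ?\<Xi>"
      obtain \<eta> where \<eta>: "\<eta> \<in> ?Y" "infdist \<xi> ?Y = dist \<xi> \<eta>"
        using infdist_attains_inf[OF Y(2) neY] by metis
      have "f \<xi> \<le> v \<bullet> (\<xi> - \<mu>) - z1 + (w \<bullet> (\<xi> - \<mu>) - z2)"
        using f[of \<xi>] by (simp add: inner_add_left)
      \<comment> \<open>The \<open>w\<close> part is nonpositive on the large ellipsoid, and
        \<open>z1\<close> dominates the value of \<open>v\<close> at the nearest point
        \<open>\<eta>\<close>.\<close>
      also have "\<dots> \<le> v \<bullet> (\<xi> - \<mu>) - v \<bullet> (\<eta> - \<mu>)"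
        using z1 z2 \<eta>(1) \<open>\<xi> \<in> ?\<Xi>\<close> by fastforce
      also have "\<dots> = v \<bullet> (\<xi> - \<eta>)" by (simp add: inner_diff_right)
      also have "\<dots> \<le> norm v * norm (\<xi> - \<eta>)" by (rule norm_cauchy_schwarz)
      also have "\<dots> \<le> c * norm (\<xi> - \<eta>)" using v by (rule mult_right_mono) simp
      finally show "f \<xi> \<le> c * infdist \<xi> ?Y" by (simp add: \<eta>(2) dist_norm)
    qed
  next
    assume ?lhs
    then have f_le: "f \<xi> \<le> c * infdist \<xi> ?Y" if "\<xi> \<in> ?\<Xi>" for \<xi>
      using that by (simp add: f_def)
    have aff: "concave_on UNIV (\<lambda>\<xi>. u \<bullet> \<xi> + s)" for u :: "real^'p" and s
    proof -
      have "a * (u \<bullet> x + s) + b * (u \<bullet> y + s) \<le> u \<bullet> (a *\<^sub>R x + b *\<^sub>R y) + s"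
        if "a + b = 1" for a b :: real and x y
      proof -
        have b: "b = 1 - a" using that by simp
        show ?thesis unfolding b by (simp add: inner_add_right algebra_simps)
      qed
      then show ?thesis by (simp add: concave_on_iff)
    qed
    have f: "concave_on UNIV f"
      unfolding f_def by (rule concave_on_diff[OF aff convex_on_psd[OF assms(5)]])
    have dist: "convex_on UNIV (\<lambda>\<xi>. c * infdist \<xi> ?Y)"
      by (rule convex_on_cmul[OF assms(6) convex_on_infdist[OF Y(1,2) neY]])
    have zero: "convex_on ?\<Xi> (\<lambda>_. 0)" using \<Xi>(1) by (simp add: convex_on_def)
    \<comment> \<open>This trades the restriction to \<open>?\<Xi>\<close> for an affine term: the
      resulting inequality holds on the whole space.\<close>
    obtain w c2 where w: "\<And>\<xi>. f \<xi> - c * infdist \<xi> ?Y \<le> w \<bullet> \<xi> + c2"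
        "\<And>\<xi>. \<xi> \<in> ?\<Xi> \<Longrightarrow> w \<bullet> \<xi> + c2 \<le> 0"
    proof (rule affine_sandwich[OF concave_on_diff[OF f dist] zero])
      show "?\<Xi> \<noteq> {}" using \<Xi>(2) by blast
      show "f \<xi> - c * infdist \<xi> ?Y \<le> 0" if "\<xi> \<in> ?\<Xi>" for \<xi>
        using f_le[OF that] by simp
    qed blast
    have f2: "concave_on UNIV (\<lambda>\<xi>. f \<xi> + ((- w) \<bullet> \<xi> + - c2))"
      by (rule concave_on_add[OF f aff])
    obtain v c1 where v: "\<And>\<xi>. f \<xi> + ((- w) \<bullet> \<xi> + - c2) \<le> v \<bullet> \<xi> + c1"
        "\<And>\<xi>. v \<bullet> \<xi> + c1 \<le> c * infdist \<xi> ?Y"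
    proof (rule affine_sandwich[OF f2 dist])
      show "f \<xi> + ((- w) \<bullet> \<xi> + - c2) \<le> c * infdist \<xi> ?Y" for \<xi>
        using w(1)[of \<xi>] by simp
    qed auto
    \<comment> \<open>An affine minorant of \<open>c * infdist \<xi> ?Y\<close> cannot have slope
      above \<open>c\<close>. Along the ray from \<open>\<mu>\<close> in direction \<open>v\<close>
      it grows by \<open>s * (norm v)\<^sup>2\<close>, while the bound grows by at most
      \<open>c * s * norm v\<close>.\<close>
    have "norm v \<le> c"
    proof (rule ccontr)
      assume "\<not> norm v \<le> c"
      then have pos: "0 < norm v - c" "0 < norm v" using assms(6) by auto
      define d where "d = - (v \<bullet> \<mu> + c1)"
      \<comment> \<open>Chosen so that the excess growth equals \<open>\<bar>d\<bar> + 1\<close>,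
        more than the offset \<open>d\<close> can absorb.\<close>
      define s where "s = (\<bar>d\<bar> + 1) / (norm v * (norm v - c))"
      have s: "0 < s" using pos by (simp add: s_def)
      have "v \<bullet> (\<mu> + s *\<^sub>R v) + c1 \<le> c * infdist (\<mu> + s *\<^sub>R v) ?Y" by (rule v(2))
      also have "\<dots> \<le> c * dist (\<mu> + s *\<^sub>R v) \<mu>"
        by (intro mult_left_mono infdist_le Y(3) assms(6))
      finally have "s * (norm v)\<^sup>2 - d \<le> c * (s * norm v)"
        using s by (simp add: dist_norm inner_add_right d_def power2_norm_eq_inner)
      moreover have "s * (norm v * (norm v - c)) = \<bar>d\<bar> + 1"
        using pos by (simp add: s_def)
      ultimately show False by (simp add: algebra_simps power2_eq_square)
    qed
    \<comment> \<open>Recentring the affine functions at \<open>\<mu>\<close> gives the witnesses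
      \<open>- c1 - v \<bullet> \<mu>\<close> for \<open>z1\<close> and
      \<open>- c2 - w \<bullet> \<mu>\<close> for \<open>z2\<close>. On \<open>?Y\<close> the
      distance vanishes, so \<open>v \<bullet> \<xi> + c1\<close> is nonpositive there.\<close>
    moreover have "sqrt \<rho>1 * norm (S *v v) \<le> - c1 - v \<bullet> \<mu>"
      unfolding supportY
    proof
      fix \<xi> assume "\<xi> \<in> ?Y"
      then show "v \<bullet> (\<xi> - \<mu>) \<le> - c1 - v \<bullet> \<mu>" using v(2)[of \<xi>] by (simp add: inner_diff_right)
    qed
    moreover have "sqrt \<rho>2 * norm (S *v w) \<le> - c2 - w \<bullet> \<mu>"
      unfolding support\<Xi>
    proof
      fix \<xi> assume "\<xi> \<in> ?\<Xi>"
      then show "w \<bullet> (\<xi> - \<mu>) \<le> - c2 - w \<bullet> \<mu>" using w(2)[of \<xi>] by (simp add: inner_diff_right)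
    qed
    moreover have "f \<xi> \<le> (v + w) \<bullet> (\<xi> - \<mu>) - (- c1 - v \<bullet> \<mu>) - (- c2 - w \<bullet> \<mu>)" for \<xi>
      using v(1)[of \<xi>] by (simp add: inner_diff_right inner_add_left)
    ultimately show ?rhs
      unfolding f_def[symmetric] by blast
  qed
qed

section \<open>Bordered matrices and inhomogeneous quadratics\<close>

lemma bordered_quadratic_form:
  fixes A :: "real^'p^'p" and y :: "real^('p + unit)"
  defines "x \<equiv> \<chi> i. y $ Inl i" and "s \<equiv> y $ Inr ()"
  shows "y \<bullet> (bordered A u c *v y) = x \<bullet> (A *v x) + 2 * s * (u \<bullet> x) + c * s\<^sup>2"
proof -
  have sum_split: "(\<Sum>i\<in>UNIV. F i) = (\<Sum>i\<in>UNIV. F (Inl i)) + F (Inr ())"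
    for F :: "'p + unit \<Rightarrow> real"
    by (simp flip: UNIV_Plus_UNIV add: sum.Plus UNIV_unit)
  have "y \<bullet> (bordered A u c *v y)
      = (\<Sum>i\<in>UNIV. x $ i * ((A *v x) $ i + u $ i * s)) + s * ((\<Sum>i\<in>UNIV. u $ i * x $ i) + c * s)"
    by (simp add: inner_vec_def matrix_vector_mult_def bordered_def sum_split x_def s_def)
  also have "\<dots> = x \<bullet> (A *v x) + s * (u \<bullet> x) + s * (u \<bullet> x + c * s)"
    by (simp add: inner_vec_def distrib_left sum.distrib sum_distrib_left mult_ac)
  finally show ?thesis by (simp add: algebra_simps power2_eq_square)
qed

text \<open>Homogenisation: last coordinate 1 recovers the inhomogeneous quadratic. A nonzero last
  coordinate \<open>s\<close> reduces to it by scaling with \<open>s\<^sup>2\<close>; for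
  \<open>s = 0\<close> only the form of \<open>A\<close> remains.\<close>

lemma psd_bordered_iff:
  fixes A :: "real^'p^'p"
  assumes "psd A"
  shows "psd (bordered A u c) \<longleftrightarrow> (\<forall>x. 0 \<le> x \<bullet> (A *v x) + 2 * (u \<bullet> x) + c)"
    (is "?lhs \<longleftrightarrow> ?rhs")
proof
  assume psd: ?lhs
  show ?rhs
  proof
    fix x
    define y :: "real^('p + unit)" where "y = (\<chi> i. case i of Inl j \<Rightarrow> x $ j | Inr _ \<Rightarrow> 1)"
    have "0 \<le> y \<bullet> (bordered A u c *v y)" using psd by (simp add: psd_def)
    then show "0 \<le> x \<bullet> (A *v x) + 2 * (u \<bullet> x) + c"
      unfolding bordered_quadratic_form by (simp add: y_def)
  qed
next
  assume nonneg: ?rhs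
  have A: "A $ i $ j = A $ j $ i" for i j
  proof -
    have "A $ i $ j = transpose A $ j $ i" by (simp add: transpose_def)
    then show ?thesis using assms by (simp add: psd_def)
  qed
  have "transpose (bordered A u c) = bordered A u c"
    by (auto simp: vec_eq_iff transpose_def bordered_def A split: sum.split)
  moreover have "0 \<le> y \<bullet> (bordered A u c *v y)" for y
  proof -
    define x where "x = (\<chi> i. y $ Inl i)"
    define s where "s = y $ Inr ()"
    have "0 \<le> x \<bullet> (A *v x) + 2 * s * (u \<bullet> x) + c * s\<^sup>2"
    proof (cases "s = 0")
      case True
      then show ?thesis using assms by (simp add: psd_def)
    next
      case False
      let ?x = "(1 / s) *\<^sub>R x"
      have "0 \<le> s\<^sup>2 * (?x \<bullet> (A *v ?x) + 2 * (u \<bullet> ?x) + c)"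
        by (rule mult_nonneg_nonneg[OF zero_le_power2 nonneg[rule_format]])
      also have "\<dots> = x \<bullet> (A *v x) + 2 * s * (u \<bullet> x) + c * s\<^sup>2"
        using False by (simp add: matrix_vector_mult_scaleR field_simps power2_eq_square)
      finally show ?thesis .
    qed
    then show ?thesis unfolding bordered_quadratic_form x_def s_def .
  qed
  ultimately show ?lhs by (simp add: psd_def)
qed

section \<open>Equivalence of the two feasible sets\<close>

lemma max_affine_le_iff:
  "max_affine a b x \<xi> \<le> m \<longleftrightarrow> (\<forall>k. a k x \<bullet> \<xi> + b k x \<le> m)"
  by (auto simp: max_affine_def)

text \<open>For fixed \<open>(x, \<Lambda>, q, t, r)\<close> the maximum splits into one constraint
  per piece, with slope \<open>a k x - q\<close>, offset \<open>b k x - t\<close> and distance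
  factor \<open>r * \<theta>\<close>. Multipliers of different pieces do not interact.\<close>

lemma feasible_iff:
  fixes S \<Sigma> :: "real^'p^'p" and a :: "'k::finite \<Rightarrow> real^'n \<Rightarrow> real^'p"
  assumes "invertible S" and "\<Sigma> = transpose S ** S" and "0 \<le> \<rho>1" "0 \<le> \<rho>2" and "0 \<le> \<theta>"
  shows "(x, \<Lambda>, q, t, r) \<in> sip_feasible X (max_affine a b) (transport_cost \<theta>)
            (ellipsoid \<Sigma> \<mu> \<rho>1) (ellipsoid \<Sigma> \<mu> \<rho>2) \<longleftrightarrow>
     (\<exists>v w z1 z2. ((x, \<Lambda>, q, t, r), v, w, z1, z2) \<in> sdp_feasible X a b S \<mu> \<rho>1 \<rho>2 \<theta>)"
\<comment> \<open>These constraints are common to both problems; if they fail, both sides are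
  false.\<close>
proof (cases "psd \<Lambda> \<and> 0 \<le> r \<and> x \<in> X")
  case False
  then show ?thesis by (auto simp: sip_feasible_def sdp_feasible_def)
next
  case True
  let ?Y = "ellipsoid \<Sigma> \<mu> \<rho>1" and ?\<Xi> = "ellipsoid \<Sigma> \<mu> \<rho>2"
  have INF: "(INF \<eta>\<in>?Y. transport_cost \<theta> \<xi> \<eta>) = \<theta> * infdist \<xi> ?Y" for \<xi>
    using closed_ellipsoid[OF assms(1-3), of \<mu>] center_in_ellipsoid[OF assms(1-3), of \<mu>] assms(5)
    by (intro INF_transport_cost) auto
  let ?P = "\<lambda>k v w z1 z2. psd (bordered \<Lambda> ((1/2) *\<^sub>R (v + w + q - a k x))
                 (t - b k x - \<mu> \<bullet> (v + w) - z1 - z2))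
        \<and> sqrt \<rho>1 * norm (S *v v) \<le> z1 \<and> sqrt \<rho>2 * norm (S *v w) \<le> z2 \<and> norm v \<le> r * \<theta>"
  have piece: "(\<forall>\<xi>\<in>?\<Xi>. (a k x - q) \<bullet> \<xi> + (b k x - t) - \<xi> \<bullet> (\<Lambda> *v \<xi>) \<le> (r * \<theta>) * infdist \<xi> ?Y)
      \<longleftrightarrow> (\<exists>v w z1 z2. ?P k v w z1 z2)" for k
  proof -
    have "psd (bordered \<Lambda> ((1/2) *\<^sub>R (v + w + q - a k x)) (t - b k x - \<mu> \<bullet> (v + w) - z1 - z2))
      \<longleftrightarrow> (\<forall>\<xi>. (a k x - q) \<bullet> \<xi> + (b k x - t) - \<xi> \<bullet> (\<Lambda> *v \<xi>) \<le> (v + w) \<bullet> (\<xi> - \<mu>) - z1 - z2)"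
      for v w z1 z2
      unfolding psd_bordered_iff[OF conjunct1[OF True]]
      by (intro all_cong1)
        (simp add: inner_add_left inner_add_right inner_diff_left inner_diff_right
          inner_commute[of \<mu>], argo)
    then show ?thesis
      using True assms by (subst semi_infinite_iff_multipliers[of S \<Sigma>]) simp_all
  qed
  have "(x, \<Lambda>, q, t, r) \<in> sip_feasible X (max_affine a b) (transport_cost \<theta>) ?Y ?\<Xi> \<longleftrightarrow>
     (\<forall>\<xi>\<in>?\<Xi>. max_affine a b x \<xi> \<le> \<xi> \<bullet> (\<Lambda> *v \<xi>) + q \<bullet> \<xi> + t + (r * \<theta>) * infdist \<xi> ?Y)"
    using True by (simp add: sip_feasible_def INF algebra_simps)
  also have "\<dots> \<longleftrightarrow>
     (\<forall>k. \<forall>\<xi>\<in>?\<Xi>. (a k x - q) \<bullet> \<xi> + (b k x - t) - \<xi> \<bullet> (\<Lambda> *v \<xi>) \<le> (r * \<theta>) * infdist \<xi> ?Y)"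
    unfolding max_affine_le_iff by (auto simp: inner_diff_left algebra_simps)
  also have "\<dots> \<longleftrightarrow> (\<forall>k. \<exists>v w z1 z2. ?P k v w z1 z2)"
    by (simp only: piece)
  \<comment> \<open>Choice collects the multipliers of the single pieces into families indexed by
    \<open>k\<close>.\<close>
  also have "\<dots> \<longleftrightarrow> (\<exists>v w z1 z2. \<forall>k. ?P k (v k) (w k) (z1 k) (z2 k))"
    by (simp only: choice_iff)
  also have "\<dots> \<longleftrightarrow> (\<exists>v w z1 z2. ((x, \<Lambda>, q, t, r), v, w, z1, z2)
      \<in> sdp_feasible X a b S \<mu> \<rho>1 \<rho>2 \<theta>)"
    using True by (simp add: sdp_feasible_def)
  finally show ?thesis .
qed

section \<open>Optimal values and solutions under projection\<close>

lemma optimal_value_fst_image: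
  assumes "\<And>z. z \<in> G \<Longrightarrow> g z = f (fst z)"
  shows "optimal_value f (fst ` G) = optimal_value g G"
  using assms by (simp add: optimal_value_def image_image cong: image_cong)

text \<open>The objective is constant on the fibres of \<open>fst\<close>, so a point of
  \<open>G\<close> is minimal exactly when its projection is.\<close>

lemma optimal_solutions_fst_image:
  assumes "\<And>z. z \<in> G \<Longrightarrow> g z = f (fst z)"
  shows "optimal_solutions f (fst ` G) = fst ` optimal_solutions g G"
proof -
  have min: "is_arg_min f (\<lambda>y. y \<in> fst ` G) (fst z) \<longleftrightarrow> is_arg_min g (\<lambda>y. y \<in> G) z"
    if "z \<in> G" for z
    using that assms by (auto simp: is_arg_min_def)
  have "optimal_solutions f (fst ` G) = fst ` {z \<in> G. is_arg_min f (\<lambda>y. y \<in> fst ` G) (fst z)}"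
    unfolding optimal_solutions_def is_arg_min_def by blast
  also have "{z \<in> G. is_arg_min f (\<lambda>y. y \<in> fst ` G) (fst z)} = optimal_solutions g G"
    using min unfolding optimal_solutions_def is_arg_min_def by blast
  finally show ?thesis .
qed

theorem theorem2p6:
  fixes \<gamma>1 \<gamma>2 \<gamma>bar1 \<gamma>bar2 \<theta> d0 :: real
    and \<Sigma>0 S :: "real^'p^'p"
    and \<mu>0 \<mu>bar :: "real^'p"
    and X :: "(real^'n) set"
    and a :: "'k::finite \<Rightarrow> real^'n \<Rightarrow> real^'p"
    and b :: "'k \<Rightarrow> real^'n \<Rightarrow> real"
    and h :: "real^'n \<Rightarrow> real^'p \<Rightarrow> real"
    and \<phi> :: "real^'p \<Rightarrow> real^'p \<Rightarrow> real"
    and Y \<Xi> :: "(real^'p) set"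
  assumes "0 < \<gamma>1" and "0 < \<gamma>2"
    and "pd \<Sigma>0" and "\<Sigma>0 = transpose S ** S"
    and "0 < \<gamma>bar1" and "\<gamma>bar1 < \<gamma>bar2"
    and "0 \<le> \<theta>"
    and "closed X" and "convex X"
    and "\<And>k. linear (a k)" and "\<And>k. linear (b k)"
    and "h = max_affine a b"
    and "\<phi> = transport_cost \<theta>"
    and "Y = ellipsoid \<Sigma>0 \<mu>bar \<gamma>bar1"
    and "\<Xi> = ellipsoid \<Sigma>0 \<mu>bar \<gamma>bar2"
  shows
    "(\<forall>x \<Lambda> q t r.
        (x, \<Lambda>, q, t, r) \<in> sip_feasible X h \<phi> Y \<Xi> \<longleftrightarrow>
        (\<exists>v w z1 z2. ((x, \<Lambda>, q, t, r), v, w, z1, z2)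
           \<in> sdp_feasible X a b S \<mu>bar \<gamma>bar1 \<gamma>bar2 \<theta>))
   \<and> (\<forall>x \<Lambda> q t r (v :: 'k \<Rightarrow> real^'p) w z1 z2.
        sdp_objective \<gamma>1 \<gamma>2 \<Sigma>0 S \<mu>0 d0 ((x :: real^'n, \<Lambda>, q, t, r), v, w, z1, z2)
          = sip_objective \<gamma>1 \<gamma>2 \<Sigma>0 S \<mu>0 d0 (x, \<Lambda>, q, t, r))
   \<and> optimal_value (sip_objective \<gamma>1 \<gamma>2 \<Sigma>0 S \<mu>0 d0) (sip_feasible X h \<phi> Y \<Xi>)
       = optimal_value (sdp_objective \<gamma>1 \<gamma>2 \<Sigma>0 S \<mu>0 d0)
           (sdp_feasible X a b S \<mu>bar \<gamma>bar1 \<gamma>bar2 \<theta>)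
   \<and> optimal_solutions (sip_objective \<gamma>1 \<gamma>2 \<Sigma>0 S \<mu>0 d0) (sip_feasible X h \<phi> Y \<Xi>)
       = fst ` optimal_solutions (sdp_objective \<gamma>1 \<gamma>2 \<Sigma>0 S \<mu>0 d0)
           (sdp_feasible X a b S \<mu>bar \<gamma>bar1 \<gamma>bar2 \<theta>)"
proof -
  let ?F = "sip_feasible X h \<phi> Y \<Xi>"
    and ?G = "sdp_feasible X a b S \<mu>bar \<gamma>bar1 \<gamma>bar2 \<theta>"
    and ?f = "sip_objective \<gamma>1 \<gamma>2 \<Sigma>0 S \<mu>0 d0 :: ('n, 'p) sip_vars \<Rightarrow> real"
    and ?g = "sdp_objective \<gamma>1 \<gamma>2 \<Sigma>0 S \<mu>0 d0 :: ('n, 'p, 'k) sdp_vars \<Rightarrow> real"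
  have feas: "(x, \<Lambda>, q, t, r) \<in> ?F \<longleftrightarrow> (\<exists>v w z1 z2. ((x, \<Lambda>, q, t, r), v, w, z1, z2) \<in> ?G)"
    for x \<Lambda> q t r
    unfolding \<open>h = _\<close> \<open>\<phi> = _\<close> \<open>Y = _\<close> \<open>\<Xi> = _\<close>
    using assms(5-7) invertible_factor[OF assms(3,4)] assms(4) by (intro feasible_iff) simp_all
  have obj: "?g z = ?f (fst z)" for z
    by (cases "(\<gamma>1, \<gamma>2, \<Sigma>0, S, \<mu>0, d0, z)" rule: sdp_objective.cases) simp
  \<comment> \<open>The feasibility equivalence says that the semi-infinite feasible set is the
    projection of the semidefinite one.\<close>
  have F: "?F = fst ` ?G"
  proof (intro set_eqI)
    fix y :: "('n, 'p) sip_vars"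
    obtain x \<Lambda> q t r where y: "y = (x, \<Lambda>, q, t, r)" by (cases y)
    show "y \<in> ?F \<longleftrightarrow> y \<in> fst ` ?G"
      unfolding y feas by (simp add: image_iff Bex_def)
  qed
  show ?thesis
    unfolding F optimal_value_fst_image[of ?G ?g ?f, OF obj]
      optimal_solutions_fst_image[of ?G ?g ?f, OF obj]
    using feas obj unfolding F by (intro conjI allI) simp_all
qed

end
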